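(* Let $F$ be a free knot diagram with $n$ crossings. If each crossing of $F$ is independently assigned one of its two possible over/under choices uniformly at random, then the resulting knot is the unknot with probability at least $\frac{2n}{2^n}$. Equivalently, at least $2n$ of the $2^n$ assignments of over/under data to the crossings of $F$ produce a diagram of the unknot.
   Context: A free knot diagram is the projection of a knot to the plane which does not record over/under information, i.e. the image of a closed curve (an immersed circle) in the plane whose only singularities are finitely many transverse double points; it is regarded as a planar 4-valent graph up to planar isotopy. The double points are called (free) crossings. An assignment of a free knot diagram is a choice, at each crossing, of which of the two strands is the overstrand; an $n$-crossing free knot diagram thus has $2^n$ assignments, each of which gives a knot diagram and hence a knot. *)

theory Defs
  imports "HOL-Analysis.Analysis" "HOL-Probability.Probability"
begin

text \<open>
  The plane is \<open>complex\<close>; three-space is \<open>complex \<times> real\<close> (isometric to Euclidean 3-space, as the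
  product carries the Euclidean norm), projected to the plane along the second component.
  Closed curves are parametrised by the reals with period 1, so that \<open>{0..<1}\<close> lists each
  point of the parameter circle exactly once.
\<close>

definition closed_C1_curve :: "(real \<Rightarrow> 'a::real_normed_vector) \<Rightarrow> bool" where
  "closed_C1_curve c \<longleftrightarrow> (\<forall>t. c (t + 1) = c t) \<and> c C1_differentiable_on UNIV"

definition immersed_circle :: "(real \<Rightarrow> complex) \<Rightarrow> bool" where
  "immersed_circle \<gamma> \<longleftrightarrow> closed_C1_curve \<gamma> \<and> (\<forall>t. vector_derivative \<gamma> (at t) \<noteq> 0)"

text \<open>The strands of the curve through a point are identified with their parameter values.\<close>

definition strands :: "(real \<Rightarrow> complex) \<Rightarrow> complex \<Rightarrow> real set" where
  "strands \<gamma> p = {t \<in> {0..<1}. \<gamma> t = p}"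

definition crossings :: "(real \<Rightarrow> complex) \<Rightarrow> complex set" where
  "crossings \<gamma> = {p. \<exists>s \<in> strands \<gamma> p. \<exists>t \<in> strands \<gamma> p. s \<noteq> t}"

text \<open>
  Transversality: \<open>\<not> collinear {0, v, w}\<close> says that the two tangent vectors are linearly
  independent (this excludes \<open>v = w\<close>, which \<open>independent {v, w}\<close> would not).
\<close>

definition free_knot_diagram :: "(real \<Rightarrow> complex) \<Rightarrow> bool" where
  "free_knot_diagram \<gamma> \<longleftrightarrow>
     immersed_circle \<gamma> \<and> finite (crossings \<gamma>) \<and>
     (\<forall>p \<in> crossings \<gamma>. card (strands \<gamma> p) = 2 \<and>
        (\<forall>s \<in> strands \<gamma> p. \<forall>t \<in> strands \<gamma> p. s \<noteq> t \<longrightarrow>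
           \<not> collinear {0, vector_derivative \<gamma> (at s), vector_derivative \<gamma> (at t)}))"

text \<open>An assignment \<open>a\<close> chooses at each crossing \<open>p\<close> the overstrand \<open>a p\<close>.\<close>

definition assignments :: "(real \<Rightarrow> complex) \<Rightarrow> (complex \<Rightarrow> real) set" where
  "assignments \<gamma> = (\<Pi>\<^sub>E p \<in> crossings \<gamma>. strands \<gamma> p)"

lemma card_assignments:
  assumes "free_knot_diagram \<gamma>"
  shows "card (assignments \<gamma>) = 2 ^ card (crossings \<gamma>)"
  using assms by (simp add: free_knot_diagram_def assignments_def card_PiE)

text \<open>
  One of the two strands is chosen uniformly and independently at each crossing; the value
  \<open>undefined\<close> outside the crossings agrees with the convention of \<open>\<Pi>\<^sub>E\<close>.
\<close>

definition random_assignment :: "(real \<Rightarrow> complex) \<Rightarrow> (complex \<Rightarrow> real) pmf" where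
  "random_assignment \<gamma> =
     Pi_pmf (crossings \<gamma>) undefined (\<lambda>p. pmf_of_set (strands \<gamma> p))"

text \<open>
  \<open>K\<close> is a knot in three-space whose diagram is \<open>\<gamma>\<close> with over/under data \<open>a\<close>. Such a \<open>K\<close> is
  automatically embedded, and it is determined by \<open>\<gamma>\<close> and \<open>a\<close> up to ambient isotopy along the
  fibres of the projection.
\<close>

definition is_diagram_of ::
  "(real \<Rightarrow> complex) \<Rightarrow> (complex \<Rightarrow> real) \<Rightarrow> (complex \<times> real) set \<Rightarrow> bool" where
  "is_diagram_of \<gamma> a K \<longleftrightarrow>
     (\<exists>h :: real \<Rightarrow> real. closed_C1_curve h \<and>
        (\<forall>p \<in> crossings \<gamma>. \<forall>s \<in> strands \<gamma> p. s \<noteq> a p \<longrightarrow> h s < h (a p)) \<and>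
        K = range (\<lambda>t. (\<gamma> t, h t)))"

definition ambient_isotopic :: "'a::topological_space set \<Rightarrow> 'a set \<Rightarrow> bool" where
  "ambient_isotopic K L \<longleftrightarrow>
     (\<exists>f. homotopic_with_canon (\<lambda>\<phi>. \<exists>\<psi>. homeomorphism UNIV UNIV \<phi> \<psi>) UNIV UNIV id f \<and> f ` K = L)"

definition unknot :: "(complex \<times> real) set \<Rightarrow> bool" where
  "unknot K \<longleftrightarrow> ambient_isotopic K (sphere 0 1 \<times> {0})"

definition yields_unknot :: "(real \<Rightarrow> complex) \<Rightarrow> (complex \<Rightarrow> real) \<Rightarrow> bool" where
  "yields_unknot \<gamma> a \<longleftrightarrow> (\<exists>K. is_diagram_of \<gamma> a K \<and> unknot K)"

end

theory Submission
  imports Defs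
begin

text \<open>
  Cut the diagram on a crossing-free arc and let the height have its maximum and its minimum on
  that arc, with no other critical points. The knot then meets every intermediate level in exactly
  two points, and the similarities of the levels that straighten these pairs depend continuously
  on the height, up to and including the extreme levels because the curve is immersed. So the knot
  is an unknot, and it is a diagram for the descending or the ascending assignment of the cut.

  Order the crossings by their first passage and let \<open>m\<close> be the last one. Cutting right after the
  first passage through \<open>q \<noteq> m\<close>, or at the base point, gives \<open>n\<close> descending assignments: the latest
  crossing whose strands are swapped tells them apart. They all agree at \<open>m\<close>, and there the
  corresponding \<open>n\<close> ascending assignments differ from them, so that \<open>2n\<close> assignments arise.
\<close>

section \<open>Reparametrising the circle by a Moebius map\<close>

text \<open>The cut points \<open>x\<close> and \<open>y\<close> move to the parameters 0 and 1/2,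
  where \<open>cos (2 * pi * s)\<close> has its maximum and minimum. Moebius transformations of the
  unit circle can take any pair of points to any other, and their lifts are explicit smooth
  functions with positive derivative, so a C1 height remains C1 after the change of
  parameter.\<close>

lemma reparametrisation_exists:
  fixes x y :: real
  assumes "x < y" "y < x + 1"
  obtains \<psi> \<psi>' \<phi> :: "real \<Rightarrow> real" where
    "\<And>s. \<psi> (s + 1) = \<psi> s + 1"
    "\<And>s. (\<psi> has_real_derivative \<psi>' s) (at s)" "\<And>s. \<psi>' s > 0" "continuous_on UNIV \<psi>'"
    "\<psi> 0 = x" "\<psi> (1/2) = y"
    "\<And>s. \<phi> (\<psi> s) = s" "\<And>t. \<psi> (\<phi> t) = t"
    "strict_mono \<phi>" "\<And>t. (\<phi> has_real_derivative inverse (\<psi>' (\<phi> t))) (at t)"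
proof -
  define w where "w = (y - x) / 2"
  \<comment> \<open>The images of 0 and 1/2 have to be \<open>2 * w\<close> apart, which amounts to
    \<open>arctan b / pi = w - 1/4\<close>.\<close>
  define b where "b = tan (pi * (w - 1/4))"
  have w: "0 < w" "w < 1/2" using assms by (auto simp: w_def)
  have range: "- (pi/4) < pi * (w - 1/4)" "pi * (w - 1/4) < pi/4"
    using w pi_gt_zero by (auto simp: field_simps)
  have "tan (- (pi/4)) < b" "b < tan (pi/4)"
    unfolding b_def by (intro tan_monotone; use range in linarith)+
  then have b: "\<bar>b\<bar> < 1" by (simp add: tan_45)
  have arctan_b: "arctan b = pi * (w - 1/4)"
    unfolding b_def by (rule arctan_tan) (use range in linarith)+
  \<comment> \<open>\<open>\<psi>\<close> lifts a Moebius transformation of the unit circle.\<close>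
  define k where "k = (\<lambda>s. b * sin (2 * pi * (s - 1/4)) / (1 - b * cos (2 * pi * (s - 1/4))))"
  define \<psi> where "\<psi> = (\<lambda>s. (x + y) / 2 + (s - 1/4) + arctan (k s) / pi)"
  \<comment> \<open>With u = 2 pi (s - 1/4), \<open>arctan (k s)\<close> is minus the argument of 1
    - b e^(iu), so up to a rotation \<open>\<psi>\<close> lifts the map from e^(iu) to (e^(iu) - b)
    / (1 - b e^(iu)). Its derivative is the Poisson kernel, with denominator |1 - b
    e^(iu)|^2.\<close>
  define \<psi>' where "\<psi>' = (\<lambda>s. (1 - b\<^sup>2) / (1 - 2 * b * cos (2 * pi * (s - 1/4)) + b\<^sup>2))"
  have "\<bar>b * cos u\<bar> < 1" for u
    using mult_mono[of "\<bar>b\<bar>" "\<bar>b\<bar>" "\<bar>cos u\<bar>" 1] b by (simp add: abs_mult)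
  then have den1: "1 - b * cos u > 0" for u by (smt (verit))
  have b2: "b\<^sup>2 < 1" using b by (simp add: abs_square_less_1)
  have den_eq: "1 - 2 * b * cos u + b\<^sup>2 = (1 - b * cos u)\<^sup>2 + (b * sin u)\<^sup>2" for u
    using sin_cos_squared_add[of u] by algebra
  have den2: "1 - 2 * b * cos u + b\<^sup>2 > 0" for u
    unfolding den_eq using den1[of u] by (simp add: sum_power2_gt_zero_iff)
  have per: "\<psi> (s + 1) = \<psi> s + 1" for s
  proof -
    have "2 * pi * (s + 1 - 1/4) = 2 * pi * (s - 1/4) + 2 * pi" by (simp add: algebra_simps)
    then show ?thesis by (simp only: \<psi>_def k_def sin_periodic cos_periodic)
  qed
  have deriv: "(\<psi> has_real_derivative \<psi>' s) (at s)" for s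
  proof -
    define c where "c = cos (2 * pi * (s - 1/4))"
    define d where "d = sin (2 * pi * (s - 1/4))"
    have cd: "d\<^sup>2 + c\<^sup>2 = 1" by (simp add: c_def d_def)
    have p: "1 - b * c > 0" using den1 by (simp add: c_def)
    have q: "(1 - b * c)\<^sup>2 + (b * d)\<^sup>2 > 0" "1 - 2 * b * c + b\<^sup>2 = (1 - b * c)\<^sup>2 + (b * d)\<^sup>2"
      using den2 den_eq by (auto simp: c_def d_def)
    let ?v = "((b * (c * (2 * pi))) * (1 - b * c) - b * d * (b * (d * (2 * pi)))) / (1 - b * c)\<^sup>2"
    have "((\<lambda>s. b * sin (2 * pi * (s - 1/4)) / (1 - b * cos (2 * pi * (s - 1/4))))
       has_real_derivative ?v) (at s)"
      using p unfolding c_def d_def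
      by (auto intro!: derivative_eq_intros simp: power2_eq_square algebra_simps)
    then have k: "(k has_real_derivative ?v) (at s)" by (simp add: k_def)
    have "k s = b * d / (1 - b * c)" by (simp add: k_def c_def d_def)
    with DERIV_chain2[OF DERIV_arctan k]
    have "((\<lambda>s. arctan (k s)) has_real_derivative
        inverse (1 + (b * d / (1 - b * c))\<^sup>2) * ?v) (at s)"
      by simp
    moreover have "((\<lambda>s. (x + y) / 2 + (s - 1/4)) has_real_derivative 1) (at s)"
      by (auto intro!: derivative_eq_intros)
    ultimately have "(\<psi> has_real_derivative
        1 + inverse (1 + (b * d / (1 - b * c))\<^sup>2) * ?v / pi) (at s)"
      unfolding \<psi>_def by (intro DERIV_add DERIV_cdivide)
    also have "1 + inverse (1 + (b * d / (1 - b * c))\<^sup>2) * ?v / pi = \<psi>' s"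
    proof -
      let ?A = "1 - b * c" and ?B = "b * d"
      have v: "?v = 2 * pi * ((b * c * ?A - ?B * ?B) / ?A\<^sup>2)"
        by (simp add: field_simps)
      have "1 + (?B / ?A)\<^sup>2 = (?A\<^sup>2 + ?B\<^sup>2) / ?A\<^sup>2"
        using p by (simp add: field_simps)
      moreover have "inverse (U / V) * (2 * pi * (Z / V)) / pi = 2 * Z / U" if "V > 0" "U > 0" for U V Z
        using that by (simp add: field_simps)
      note this[of "?A\<^sup>2" "?A\<^sup>2 + ?B\<^sup>2" "b * c * ?A - ?B * ?B", OF zero_less_power[OF p] q(1)]
      ultimately have "1 + inverse (1 + (?B / ?A)\<^sup>2) * ?v / pi
          = 1 + 2 * (b * c * ?A - ?B * ?B) / (?A\<^sup>2 + ?B\<^sup>2)"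
        unfolding v by (simp only:)
      also have "\<dots> = ((?A\<^sup>2 + ?B\<^sup>2) + 2 * (b * c * ?A - ?B * ?B)) / (?A\<^sup>2 + ?B\<^sup>2)"
      proof -
        have "1 + Z / U = (U + Z) / U" if "U > 0" for U Z :: real
          using that by (simp add: field_simps)
        from this[OF q(1)] show ?thesis .
      qed
      also have "\<dots> = (1 - b\<^sup>2) / (?A\<^sup>2 + ?B\<^sup>2)"
      proof -
        have "(?A\<^sup>2 + ?B\<^sup>2) + 2 * (b * c * ?A - ?B * ?B) = 1 - b\<^sup>2 * (d\<^sup>2 + c\<^sup>2)"
          by (simp add: power2_eq_square algebra_simps)
        then show ?thesis by (simp only: cd mult_1_right)
      qed
      finally show ?thesis by (simp only: \<psi>'_def c_def[symmetric] q(2))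
    qed
    finally show ?thesis .
  qed
  have pos: "\<psi>' s > 0" for s
    unfolding \<psi>'_def using den2 b2 by (intro divide_pos_pos) auto
  have cont': "continuous_on UNIV \<psi>'"
    unfolding \<psi>'_def using den2 by (auto intro!: continuous_intros simp: less_imp_neq[symmetric])
  have ends: "\<psi> 0 = x" "\<psi> (1/2) = y"
  proof -
    have "k 0 = - b" "k (1/2) = b"
    proof -
      have q: "2 * pi * (0 - 1/4) = - (pi/2)" "2 * pi * (1/2 - 1/4) = pi/2" by auto
      show "k 0 = - b" "k (1/2) = b"
        unfolding k_def q sin_minus cos_minus sin_pi_half cos_pi_half by auto
    qed
    moreover have "arctan (- b) / pi = - (w - 1/4)" "arctan b / pi = w - 1/4"
      by (simp_all add: arctan_minus arctan_b)
    ultimately have "\<psi> 0 = (x + y) / 2 + (0 - 1/4) + - (w - 1/4)"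
      and "\<psi> (1/2) = (x + y) / 2 + (1/2 - 1/4) + (w - 1/4)"
      unfolding \<psi>_def by (simp_all only:)
    then show "\<psi> 0 = x" "\<psi> (1/2) = y" by (simp_all add: w_def field_simps)
  qed
  have sm: "strict_mono \<psi>"
  proof (rule strict_monoI)
    fix s t :: real assume "s < t"
    then show "\<psi> s < \<psi> t"
      by (rule DERIV_pos_imp_increasing) (use deriv pos in meson)
  qed
  have cont: "isCont \<psi> s" for s by (rule DERIV_isCont[OF deriv])
  \<comment> \<open>A continuous function at bounded distance from the identity is onto, by the
    intermediate value theorem.\<close>
  have near: "\<bar>\<psi> s - s\<bar> \<le> \<bar>x + y\<bar> + 2" for s
  proof -
    have "\<bar>arctan u / pi\<bar> < 1" for u
      using arctan_bounded[of u] pi_gt_zero by (simp add: abs_less_iff field_simps)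
    from this[of "k s"] have "\<bar>arctan (k s) / pi\<bar> < 1" .
    moreover have "\<psi> s = (x + y) / 2 + (s - 1/4) + arctan (k s) / pi" by (simp only: \<psi>_def)
    moreover have "\<bar>P - s\<bar> \<le> \<bar>Q\<bar> + 2" if "\<bar>A\<bar> < 1" "P = Q / 2 + (s - 1/4) + A" for P Q A :: real
      using that by linarith
    ultimately show ?thesis by blast
  qed
  have "surj \<psi>"
  proof -
    have "\<exists>s. \<psi> s = t" for t
    proof -
      let ?M = "\<bar>x + y\<bar> + 2"
      have "\<exists>s\<ge>t - ?M. s \<le> t + ?M \<and> \<psi> s = t"
      proof (rule IVT)
        show "\<psi> (t - ?M) \<le> t" "t \<le> \<psi> (t + ?M)"
          using near[of "t - ?M"] near[of "t + ?M"] by linarith+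
      qed (use cont in auto)
      then show ?thesis by blast
    qed
    then show ?thesis by (metis surjI)
  qed
  have inj: "inj \<psi>" using sm by (rule strict_mono_imp_inj_on)
  define \<phi> where "\<phi> = inv \<psi>"
  have inv1: "\<phi> (\<psi> s) = s" for s using inj by (simp add: \<phi>_def)
  have inv2: "\<psi> (\<phi> t) = t" for t using \<open>surj \<psi>\<close> by (simp add: \<phi>_def surj_f_inv_f)
  have sm': "strict_mono \<phi>"
    by (intro strict_monoI) (metis inv2 sm strict_mono_less)
  have contphi: "isCont \<phi> t" for t
  proof -
    have "isCont \<phi> (\<psi> (\<phi> t))"
      by (rule isCont_inverse_function[where d = 1]) (use inv1 cont in auto)
    then show ?thesis by (simp add: inv2)
  qed
  have "(\<phi> has_real_derivative inverse (\<psi>' (\<phi> t))) (at t)" for t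
    by (rule DERIV_inverse_function[where f = \<psi> and a = "t - 1" and b = "t + 1"])
       (use deriv pos[of "\<phi> t"] inv2 contphi in auto)
  then show ?thesis by (rule that[OF per deriv pos cont' ends inv1 inv2 sm'])
qed


section \<open>Quotients at a common zero\<close>

lemma tendsto_vector_derivative_slope:
  assumes "(f has_vector_derivative d) (at a)"
  shows "((\<lambda>s. (f s - f a) /\<^sub>R (s - a)) \<longlongrightarrow> d) (at a)"
proof (rule Lim_null[THEN iffD2], rule tendsto_norm_zero_cancel)
  have "((\<lambda>s. norm ((f s - f a - (s - a) *\<^sub>R d) /\<^sub>R norm (s - a))) \<longlongrightarrow> 0) (at a)"
    using assms by (intro tendsto_norm_zero) (simp add: has_vector_derivative_def has_derivative_at_within)
  then show "((\<lambda>s. norm ((f s - f a) /\<^sub>R (s - a) - d)) \<longlongrightarrow> 0) (at a)"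
  proof (rule Lim_transform_eventually)
    have "norm ((f s - f a - (s - a) *\<^sub>R d) /\<^sub>R norm (s - a)) = norm ((f s - f a) /\<^sub>R (s - a) - d)"
      if "s \<noteq> a" for s
    proof -
      have "(f s - f a) /\<^sub>R (s - a) - d = (f s - f a - (s - a) *\<^sub>R d) /\<^sub>R (s - a)"
        using that by (simp add: scaleR_right_diff_distrib)
      then show ?thesis by simp
    qed
    then show "\<forall>\<^sub>F s in at a. norm ((f s - f a - (s - a) *\<^sub>R d) /\<^sub>R norm (s - a)) =
        norm ((f s - f a) /\<^sub>R (s - a) - d)"
      by (auto simp: eventually_at_filter)
  qed
qed

text \<open>L'Hopital's rule for a complex numerator: dividing both functions by
  \<open>s - a\<close> leaves two difference quotients, so only the derivatives at \<open>a\<close>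
  itself enter.\<close>

lemma tendsto_divide_common_zero:
  fixes f :: "real \<Rightarrow> complex" and k :: "real \<Rightarrow> real"
  assumes "(f has_vector_derivative d) (at a)" "(k has_real_derivative e) (at a)"
    and "f a = 0" "k a = 0" "e \<noteq> 0"
  shows "((\<lambda>s. f s / of_real (k s)) \<longlongrightarrow> d / of_real e) (at a)"
proof -
  have k: "((\<lambda>s. k s / (s - a)) \<longlongrightarrow> e) (at a)"
    using assms(2,4) by (simp add: has_field_derivative_iff)
  have "((\<lambda>s. ((f s - f a) /\<^sub>R (s - a)) / of_real (k s / (s - a))) \<longlongrightarrow> d / of_real e) (at a)"
    using assms by (intro tendsto_intros tendsto_vector_derivative_slope k) auto
  then show ?thesis
  proof (rule Lim_transform_eventually)
    show "\<forall>\<^sub>F s in at a. ((f s - f a) /\<^sub>R (s - a)) / of_real (k s / (s - a)) = f s / of_real (k s)"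
      using assms(3) by (auto simp: eventually_at_filter scaleR_conv_of_real divide_simps)
  qed
qed

lemma periodic_add_int:
  fixes f :: "real \<Rightarrow> 'a"
  assumes per: "\<And>t. f (t + 1) = f t"
  shows "f (t + of_int k) = f t"
proof (induction k rule: int_induct[where k = 0])
  case (step1 i)
  then show ?case using per[of "t + of_int i"] by (simp add: add.assoc)
next
  case (step2 i)
  then show ?case using per[of "t + of_int (i - 1)"] by simp
qed simp

section \<open>Straightening a knot level by level\<close>

text \<open>Rotation of three-space about the real axis of the plane. The angle \<open>pi/2\<close>
  lays the vertical plane over that axis onto the horizontal plane.\<close>

definition tilt :: "real \<Rightarrow> complex \<times> real \<Rightarrow> complex \<times> real" where
  "tilt \<theta> p = (Complex (Re (fst p)) (cos \<theta> * Im (fst p) + sin \<theta> * snd p),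
               cos \<theta> * snd p - sin \<theta> * Im (fst p))"

lemma tilt_inverse: "tilt (- \<theta>) (tilt \<theta> p) = p" "tilt \<theta> (tilt (- \<theta>) p) = p"
proof -
  have 1: "cos \<theta> * (cos \<theta> * a + sin \<theta> * b) - sin \<theta> * (cos \<theta> * b - sin \<theta> * a) = a"
    "cos \<theta> * (cos \<theta> * b - sin \<theta> * a) + sin \<theta> * (cos \<theta> * a + sin \<theta> * b) = b"
    "cos \<theta> * (cos \<theta> * a - sin \<theta> * b) + sin \<theta> * (cos \<theta> * b + sin \<theta> * a) = a"
    "cos \<theta> * (cos \<theta> * b + sin \<theta> * a) - sin \<theta> * (cos \<theta> * a - sin \<theta> * b) = b" for a b :: real
    using sin_cos_squared_add[of \<theta>] by algebra+
  show "tilt (- \<theta>) (tilt \<theta> p) = p" "tilt \<theta> (tilt (- \<theta>) p) = p"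
    by (simp_all add: tilt_def complex_eq_iff prod_eq_iff 1)
qed

lemma continuous_on_tilt [continuous_intros]:
  fixes S :: "'a::t2_space set"
  assumes "continuous_on S g" "continuous_on S f"
  shows "continuous_on S (\<lambda>x. tilt (g x) (f x))"
  unfolding tilt_def by (intro continuous_intros assms)

text \<open>The knot is a vertical unit circle distorted by a similarity in each level. Scaling both
  the translation \<open>M\<close> and the logarithm \<open>L\<close> by a time parameter connects
  these similarities to the identity without the factor ever vanishing. As \<open>L\<close> and
  \<open>M\<close> are continuous on the whole line, every stage is a homeomorphism of the whole
  space.\<close>

lemma unknot_level_preserving_image:
  fixes L M :: "real \<Rightarrow> complex"
  assumes L: "continuous_on UNIV L" and M: "continuous_on UNIV M"
  shows "unknot (range (\<lambda>s. (M (cos (2 * pi * s)) +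
    exp (L (cos (2 * pi * s))) * of_real (sin (2 * pi * s)), cos (2 * pi * s))))"
    (is "unknot ?K")
proof -
  \<comment> \<open>At time \<open>t\<close> the level similarity is undone to the extent
    \<open>t\<close> and the result is rotated by \<open>t * (pi/2)\<close>: the identity at 0, and
    at 1 the knot has become the horizontal unit circle. The inverse \<open>H' t\<close> rotates
    back first.\<close>
  define H where "H = (\<lambda>(t :: real, p). tilt (t * (pi/2))
    ((fst p - of_real t * M (snd p)) * exp (- (of_real t * L (snd p))), snd p))"
  define H' where "H' = (\<lambda>t p. case tilt (- (t * (pi/2))) p of (w, z) \<Rightarrow>
    (w * exp (of_real t * L z) + of_real t * M z, z))"
  have L': "continuous_on S (\<lambda>x. L (f x))" and M': "continuous_on S (\<lambda>x. M (f x))"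
    if "continuous_on S f" for S :: "'a::topological_space set" and f
    using that by (auto intro: continuous_on_compose2[OF L] continuous_on_compose2[OF M])
  have contH: "continuous_on S H" for S
    unfolding H_def case_prod_unfold by (intro continuous_intros L' M')
  have contH': "continuous_on UNIV (H' t)" for t
    unfolding H'_def case_prod_unfold by (intro continuous_intros L' M')
  have "homeomorphism UNIV UNIV (\<lambda>p. H (t, p)) (H' t)" for t
  proof
    show "continuous_on UNIV (\<lambda>p. H (t, p))"
      by (rule continuous_on_compose2[OF contH[of UNIV]]) (auto intro!: continuous_intros)
    show "continuous_on UNIV (H' t)" by (rule contH')
    show "H' t (H (t, p)) = p" for p
      by (simp add: H_def H'_def tilt_inverse mult.assoc flip: exp_add)
    show "H (t, H' t p) = p" for p
    proof -
      obtain w z where wz: "tilt (- (t * (pi/2))) p = (w, z)" by fastforce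
      then have "H (t, H' t p) = tilt (t * (pi/2)) (w, z)"
        by (simp add: H_def H'_def mult.assoc flip: exp_add)
      then show ?thesis by (simp add: wz[symmetric] tilt_inverse)
    qed
  qed auto
  moreover have "H (0, p) = p" for p
    by (simp add: H_def tilt_def prod_eq_iff)
  ultimately have "homotopic_with_canon (\<lambda>\<phi>. \<exists>\<psi>. homeomorphism UNIV UNIV \<phi> \<psi>) UNIV UNIV
      id (\<lambda>p. H (1, p))"
    unfolding homotopic_with_def prod_topology_subtopology_eu continuous_map_subtopology_eu
    using contH by (intro exI[of _ H]) auto
  moreover have "(\<lambda>p. H (1, p)) ` ?K = sphere 0 1 \<times> {0}"
  proof -
    have *: "H (1, M z + exp (L z) * of_real x, z) = (Complex x z, 0)" for x z
    proof -
      have "H (1, M z + exp (L z) * of_real x, z) = tilt (pi/2) (exp (L z) * of_real x * exp (- L z), z)"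
        by (simp add: H_def)
      also have "exp (L z) * of_real x * exp (- L z) = of_real x"
        by (simp add: exp_minus)
      finally show ?thesis by (simp add: tilt_def)
    qed
    have "(\<lambda>p. H (1, p)) ` ?K = range (\<lambda>s. (Complex (sin (2 * pi * s)) (cos (2 * pi * s)), 0))"
      unfolding image_image * ..
    also have "\<dots> = sphere 0 1 \<times> {0}"
    proof safe
      fix w :: complex assume "w \<in> sphere 0 1"
      then have "(Im w)\<^sup>2 + (Re w)\<^sup>2 = 1" by (simp add: cmod_def)
      then obtain \<theta> where "Im w = cos \<theta>" "Re w = sin \<theta>" using sincos_total_2pi by metis
      then have "w = Complex (sin (2 * pi * (\<theta> / (2 * pi)))) (cos (2 * pi * (\<theta> / (2 * pi))))"
        by (simp add: complex_eq_iff)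
      then show "(w, 0) \<in> range (\<lambda>s. (Complex (sin (2 * pi * s)) (cos (2 * pi * s)), 0))"
        by blast
    qed (simp add: cmod_def)
    finally show ?thesis .
  qed
  ultimately show ?thesis
    unfolding unknot_def ambient_isotopic_def by blast
qed

section \<open>Knots whose height is a cosine\<close>

text \<open>Modulo the period, a height strictly between the extremes is attained at
  \<open>s\<close> and \<open>- s\<close> only, and \<open>level\<close> separates these two points,
  so a similarity of the level takes them to the points plus and minus
  \<open>sin (2 * pi * s)\<close>. At the extremes the points merge and the similarity factor tends
  to a multiple of the derivative, nonzero by \<open>nz\<close>.\<close>

lemma unknot_cosine_height:
  fixes \<Gamma> :: "real \<Rightarrow> complex"
  assumes per: "\<And>s. \<Gamma> (s + 1) = \<Gamma> s"
    and deriv: "\<And>s. (\<Gamma> has_vector_derivative D s) (at s)"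
    and nz: "D 0 \<noteq> 0" "D (1/2) \<noteq> 0"
    and level: "\<And>s. 0 < s \<Longrightarrow> s < 1/2 \<Longrightarrow> \<Gamma> s \<noteq> \<Gamma> (- s)"
  shows "unknot (range (\<lambda>s. (\<Gamma> s, cos (2 * pi * s))))"
proof -
  define f where "f = (\<lambda>s. \<Gamma> s - \<Gamma> (- s))"
  define k where "k = (\<lambda>s. 2 * sin (2 * pi * s))"
  \<comment> \<open>\<open>\<Gamma> = m + g sin (2 \<pi> s)\<close> with \<open>m\<close> and \<open>g\<close> even, hence functions of the height \<open>cos (2 \<pi> s)\<close>;
    at the critical heights \<open>g\<close> extends by l'Hopital.\<close>
  define g where "g = (\<lambda>s. if s = 0 then D 0 / of_real (2 * pi)
    else if s = 1/2 then - D (1/2) / of_real (2 * pi) else f s / of_real (k s))"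
  define m where "m = (\<lambda>s. (\<Gamma> s + \<Gamma> (- s)) / 2)"
  have contG: "isCont \<Gamma> s" for s
    using deriv has_vector_derivative_continuous by blast
  then have contG': "continuous_on S (\<lambda>x. \<Gamma> (h x))" if "continuous_on S h" for S :: "real set" and h
    using continuous_on_compose2[of UNIV \<Gamma> S h] that by (auto intro: continuous_at_imp_continuous_on)
  have half: "\<Gamma> (- (1/2)) = \<Gamma> (1/2)" using per[of "- (1/2)"] by simp
  \<comment> \<open>The derivative of \<open>f\<close> at 1/2 involves \<open>D (- (1/2))\<close>,
    which periodicity identifies with \<open>D (1/2)\<close>.\<close>
  have D_half: "D (- (1/2)) = D (1/2)"
  proof -
    have "((\<lambda>s::real. s + 1) has_vector_derivative 1) (at (- (1/2)))"
      by (auto simp: has_real_derivative_iff_has_vector_derivative[symmetric] intro!: derivative_eq_intros)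
    then have "((\<lambda>s. \<Gamma> (s + 1)) has_vector_derivative 1 *\<^sub>R D (1/2)) (at (- (1/2)))"
      using vector_diff_chain_at[of "\<lambda>s. s + 1" 1 "- (1/2)" \<Gamma> "D (1/2)"] deriv[of "1/2"]
      by (simp add: o_def)
    then show ?thesis
      using per deriv[of "- (1/2)"] vector_derivative_unique_at by fastforce
  qed
  have deriv_f: "(f has_vector_derivative D s + D (- s)) (at s)" for s
  proof -
    have "((\<lambda>s::real. - s) has_vector_derivative - 1) (at s)"
      by (auto simp: has_real_derivative_iff_has_vector_derivative[symmetric] intro!: derivative_eq_intros)
    then have "((\<lambda>s. \<Gamma> (- s)) has_vector_derivative (- 1) *\<^sub>R D (- s)) (at s)"
      using vector_diff_chain_at[of uminus "- 1" s \<Gamma> "D (- s)"] deriv[of "- s"]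
      by (simp add: o_def)
    from has_vector_derivative_diff[OF deriv this] show ?thesis by (simp add: f_def)
  qed
  have deriv_k: "(k has_real_derivative 4 * pi * cos (2 * pi * s)) (at s)" for s
    unfolding k_def by (auto intro!: derivative_eq_intros)
  have k_pos: "k s > 0" if "0 < s" "s < 1/2" for s
    using that unfolding k_def by (intro mult_pos_pos sin_gt_zero) auto
  have "isCont g s" if s: "0 \<le> s" "s \<le> 1/2" for s
  proof -
    consider "s = 0" | "s = 1/2" | "0 < s" "s < 1/2" using s by linarith
    then show ?thesis
    proof cases
      case 1
      have "((\<lambda>s. f s / of_real (k s)) \<longlongrightarrow> (D 0 + D (- 0)) / of_real (4 * pi * cos (2 * pi * 0))) (at 0)"
        by (rule tendsto_divide_common_zero[OF deriv_f deriv_k]) (auto simp: f_def k_def)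
      also have "(D 0 + D (- 0)) / of_real (4 * pi * cos (2 * pi * 0)) = g 0"
        by (simp add: g_def field_simps)
      finally have "(g \<longlongrightarrow> g 0) (at 0)"
        by (rule Lim_transform_within_open[where s = "{..<1/2}"]) (auto simp: g_def)
      then show ?thesis by (simp add: 1 isCont_def)
    next
      case 2
      have "((\<lambda>s. f s / of_real (k s)) \<longlongrightarrow> (D (1/2) + D (- (1/2))) / of_real (4 * pi * cos (2 * pi * (1/2)))) (at (1/2))"
        by (rule tendsto_divide_common_zero[OF deriv_f deriv_k]) (auto simp: f_def k_def half)
      also have "(D (1/2) + D (- (1/2))) / of_real (4 * pi * cos (2 * pi * (1/2))) = g (1/2)"
        by (simp add: g_def D_half field_simps)
      finally have "(g \<longlongrightarrow> g (1/2)) (at (1/2))"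
        by (rule Lim_transform_within_open[where s = "{0<..}"]) (auto simp: g_def)
      then show ?thesis by (simp add: 2 isCont_def)
    next
      case 3
      have "continuous_on {0<..<1/2} (\<lambda>s. f s / of_real (k s))"
      proof (intro continuous_on_divide continuous_on_of_real)
        show "continuous_on {0<..<1/2} f" unfolding f_def by (intro continuous_intros contG')
        show "continuous_on {0<..<1/2} k" unfolding k_def by (intro continuous_intros)
        show "\<forall>s\<in>{0<..<1/2}. complex_of_real (k s) \<noteq> 0" using k_pos by fastforce
      qed
      then have "continuous_on {0<..<1/2} g"
        by (rule continuous_on_eq) (auto simp: g_def)
      then show ?thesis using 3 by (simp add: continuous_on_eq_continuous_at)
    qed
  qed
  then have cont_g: "continuous_on {0..1/2} g" by (auto intro: continuous_at_imp_continuous_on)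
  have g_nz: "g s \<noteq> 0" if "0 \<le> s" "s \<le> 1/2" for s
    using that nz level[of s] k_pos[of s] by (auto simp: g_def f_def)
  \<comment> \<open>The parameter in [0, 1/2] of a given height. Clamping to [-1, 1] extends it
    constantly, so that the similarities are defined at every level of the space.\<close>
  define S where "S = (\<lambda>z. arccos (max (- 1) (min 1 z)) / (2 * pi))"
  have S_range: "0 \<le> S z" "S z \<le> 1/2" for z
    using arccos_bounded[of "max (- 1) (min 1 z)"] by (auto simp: S_def field_simps)
  have cont_S: "continuous_on UNIV S"
    unfolding S_def by (intro continuous_intros) auto
  have cont_gS: "continuous_on UNIV (\<lambda>z. g (S z))"
    by (rule continuous_on_compose2[OF cont_g cont_S]) (use S_range in auto)
  have cont_mS: "continuous_on UNIV (\<lambda>z. m (S z))"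
    unfolding m_def by (intro continuous_intros contG' cont_S) auto
  \<comment> \<open>A nowhere zero continuous function on the contractible real line has a
    continuous logarithm.\<close>
  obtain L where L: "continuous_on UNIV L" "\<And>z. g (S z) = exp (L z)"
    using continuous_logarithm_on_contractible[OF cont_gS] g_nz S_range
    by (metis UNIV_I convex_UNIV convex_imp_contractible)
  \<comment> \<open>On this range the arccosine recovers \<open>\<bar>s\<bar>\<close>. As
    \<open>m\<close> and the quotient of the odd functions \<open>f\<close> and \<open>k\<close> are
    even, their values there reproduce \<open>\<Gamma> s\<close> for both signs of
    \<open>s\<close>.\<close>
  have core: "m (S (cos (2 * pi * s))) + exp (L (cos (2 * pi * s))) * of_real (sin (2 * pi * s)) = \<Gamma> s"
    if s: "\<bar>s\<bar> \<le> 1/2" for s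
  proof -
    have "\<bar>2 * pi * s\<bar> \<le> pi" using s by (simp add: abs_mult)
    then have "S (cos (2 * pi * s)) = \<bar>s\<bar>"
      unfolding S_def by (simp add: arccos_cos_eq_abs abs_mult)
    moreover have "m \<bar>s\<bar> + g \<bar>s\<bar> * of_real (sin (2 * pi * s)) = \<Gamma> s"
    proof -
      consider "s = 0" | "s = 1/2" | "s = - (1/2)" | "0 < s" "s < 1/2" | "- (1/2) < s" "s < 0"
        using s by linarith
      then show ?thesis
      proof cases
        case 4
        then show ?thesis using k_pos[of s] by (simp add: m_def g_def f_def k_def field_simps)
      next
        case 5
        then show ?thesis using k_pos[of "- s"] by (simp add: m_def g_def f_def k_def field_simps)
      next
        case 2
        show ?thesis unfolding 2 by (simp add: m_def half)
      next
        case 3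
        show ?thesis unfolding 3 by (simp add: m_def half)
      qed (simp add: m_def)
    qed
    ultimately show ?thesis by (simp add: L(2)[symmetric])
  qed
  have "m (S (cos (2 * pi * s))) + exp (L (cos (2 * pi * s))) * of_real (sin (2 * pi * s)) = \<Gamma> s" for s
  proof -
    let ?s = "s - of_int (round s)"
    have p: "cos (2 * pi * (t + 1)) = cos (2 * pi * t)" "sin (2 * pi * (t + 1)) = sin (2 * pi * t)" for t
      by (simp_all add: distrib_left)
    have "\<bar>?s\<bar> \<le> 1/2" using of_int_round_abs_le[of s] by (simp add: abs_minus_commute)
    from core[OF this] show ?thesis
      using periodic_add_int[of "\<lambda>t. cos (2 * pi * t)" ?s "round s"]
        periodic_add_int[of "\<lambda>t. sin (2 * pi * t)" ?s "round s"]
        periodic_add_int[of \<Gamma> ?s "round s"] p per by simp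
  qed
  with unknot_level_preserving_image[OF L(1) cont_mS] show ?thesis by simp
qed


section \<open>A height with one maximum and one minimum\<close>

text \<open>The height is the cosine of the new parameter, with its maximum at \<open>x\<close> and
  its minimum at \<open>y\<close>. Two points at the same intermediate height lie on different open
  arcs between \<open>x\<close>, \<open>y\<close> and \<open>x + 1\<close>, and \<open>disj\<close>
  separates their projections. Crossings of an arc with itself are harmless, since the height is
  strictly monotone on each arc.\<close>

lemma unknot_height_exists:
  assumes imm: "immersed_circle \<gamma>" and xy: "x < y" "y < x + 1"
    and disj: "\<And>s t. x < s \<Longrightarrow> s < y \<Longrightarrow> y < t \<Longrightarrow> t < x + 1 \<Longrightarrow> \<gamma> s \<noteq> \<gamma> t"
  obtains h where "closed_C1_curve h" "unknot (range (\<lambda>t. (\<gamma> t, h t)))"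
    "\<And>s t. x \<le> s \<Longrightarrow> s < t \<Longrightarrow> t \<le> y \<Longrightarrow> h t < h s"
    "\<And>s t. y \<le> s \<Longrightarrow> s < t \<Longrightarrow> t \<le> x + 1 \<Longrightarrow> h s < h t"
proof -
  obtain \<psi> \<psi>' \<phi> where per: "\<And>s. \<psi> (s + 1) = \<psi> s + 1"
    and deriv: "\<And>s. (\<psi> has_real_derivative \<psi>' s) (at s)"
    and pos: "\<And>s. \<psi>' s > 0" and cont': "continuous_on UNIV \<psi>'"
    and ends: "\<psi> 0 = x" "\<psi> (1/2) = y"
    and inv: "\<And>s. \<phi> (\<psi> s) = s" "\<And>t. \<psi> (\<phi> t) = t"
    and mono: "strict_mono \<phi>" and deriv': "\<And>t. (\<phi> has_real_derivative inverse (\<psi>' (\<phi> t))) (at t)"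
    by (rule reparametrisation_exists[OF xy]) (rule that)
  from imm obtain D where \<gamma>_per: "\<And>t. \<gamma> (t + 1) = \<gamma> t"
    and D: "\<And>t. (\<gamma> has_vector_derivative D t) (at t)"
    by (auto simp: immersed_circle_def closed_C1_curve_def C1_differentiable_on_def)
  have D_nz: "D t \<noteq> 0" for t
    using imm vector_derivative_at[OF D[of t]] by (auto simp: immersed_circle_def)
  have \<phi>_per: "\<phi> (t + 1) = \<phi> t + 1" for t
    using per[of "\<phi> t"] inv by metis
  have \<phi>_ends: "\<phi> x = 0" "\<phi> y = 1/2" "\<phi> (x + 1) = 1"
    using ends inv(1) \<phi>_per[of x] by auto
  have \<psi>_less: "\<psi> s < \<psi> t" if "s < t" for s t
    using that inv strict_mono_less[OF mono] by metis
  define h where "h = (\<lambda>t. cos (2 * pi * \<phi> t))"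
  have "continuous_on UNIV \<phi>"
    by (intro continuous_at_imp_continuous_on ballI DERIV_isCont[OF deriv'])
  then have "continuous_on UNIV (\<lambda>t. - sin (2 * pi * \<phi> t) * (2 * pi * inverse (\<psi>' (\<phi> t))))"
    using pos by (intro continuous_intros continuous_on_compose2[OF cont'])
      (auto simp: less_imp_neq[symmetric])
  moreover have "(h has_real_derivative - sin (2 * pi * \<phi> t) * (2 * pi * inverse (\<psi>' (\<phi> t)))) (at t)" for t
    unfolding h_def by (auto intro!: derivative_eq_intros deriv')
  ultimately have "h C1_differentiable_on UNIV"
    unfolding C1_differentiable_on_def has_real_derivative_iff_has_vector_derivative
    by (intro exI[of _ "\<lambda>t. - sin (2 * pi * \<phi> t) * (2 * pi * inverse (\<psi>' (\<phi> t)))"]) simp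
  then have h: "closed_C1_curve h"
    by (simp add: closed_C1_curve_def h_def \<phi>_per distrib_left)
  have "unknot (range (\<lambda>s. ((\<gamma> \<circ> \<psi>) s, cos (2 * pi * s))))"
  proof (rule unknot_cosine_height)
    show "((\<gamma> \<circ> \<psi>) has_vector_derivative \<psi>' s *\<^sub>R D (\<psi> s)) (at s)" for s
      using deriv D by (intro vector_diff_chain_at) (auto simp: has_real_derivative_iff_has_vector_derivative)
    show "\<psi>' 0 *\<^sub>R D (\<psi> 0) \<noteq> 0" "\<psi>' (1/2) *\<^sub>R D (\<psi> (1/2)) \<noteq> 0"
      using pos[of 0] pos[of "1/2"] D_nz by auto
    show "(\<gamma> \<circ> \<psi>) s \<noteq> (\<gamma> \<circ> \<psi>) (- s)" if "0 < s" "s < 1/2" for s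
    proof -
      have "\<gamma> (\<psi> s) \<noteq> \<gamma> (\<psi> (1 - s))"
        using \<psi>_less[of 0 s] \<psi>_less[of s "1/2"] \<psi>_less[of "1/2" "1 - s"] \<psi>_less[of "1 - s" "0 + 1"]
          per[of 0] ends that by (intro disj) auto
      moreover have "\<psi> (1 - s) = \<psi> (- s) + 1" using per[of "- s"] by simp
      ultimately show ?thesis by (simp add: \<gamma>_per)
    qed
  qed (simp add: per \<gamma>_per)
  also have "range (\<lambda>s. ((\<gamma> \<circ> \<psi>) s, cos (2 * pi * s))) = range (\<lambda>t. (\<gamma> t, h t))"
  proof -
    have "surj \<psi>" using inv(2) by (metis surjI)
    then have "range (\<lambda>t. (\<gamma> t, h t)) = (\<lambda>t. (\<gamma> t, h t)) ` range \<psi>" by simp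
    also have "\<dots> = range (\<lambda>s. (\<gamma> (\<psi> s), h (\<psi> s)))" by (rule image_image)
    finally have "range (\<lambda>t. (\<gamma> t, h t)) = range (\<lambda>s. (\<gamma> (\<psi> s), h (\<psi> s)))" .
    then show ?thesis by (simp add: h_def inv)
  qed
  finally have "unknot (range (\<lambda>t. (\<gamma> t, h t)))" .
  moreover have "h t < h s" if "x \<le> s" "s < t" "t \<le> y" for s t
  proof -
    have "0 \<le> \<phi> s" "\<phi> s < \<phi> t" "\<phi> t \<le> 1/2"
      using that \<phi>_ends strict_mono_less[OF mono] strict_mono_less_eq[OF mono] by metis+
    then show ?thesis unfolding h_def by (intro cos_monotone_0_pi) auto
  qed
  moreover have "h s < h t" if "y \<le> s" "s < t" "t \<le> x + 1" for s t
  proof -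
    have "1/2 \<le> \<phi> s" "\<phi> s < \<phi> t" "\<phi> t \<le> 1"
      using that \<phi>_ends strict_mono_less[OF mono] strict_mono_less_eq[OF mono] by metis+
    \<comment> \<open>Reflecting the parameter moves the second arc to [0, 1/2], where the cosine
      decreases.\<close>
    then have "cos (2 * pi * (1 - \<phi> s)) < cos (2 * pi * (1 - \<phi> t))"
      by (intro cos_monotone_0_pi) auto
    moreover have "cos (2 * pi * (1 - r)) = cos (2 * pi * r)" for r
      by (simp add: right_diff_distrib cos_diff)
    ultimately show ?thesis by (simp add: h_def)
  qed
  ultimately show ?thesis by (rule that[OF h])
qed

lemma closed_C1_curve_add_int: "closed_C1_curve c \<Longrightarrow> c (t + of_int k) = c t"
  by (rule periodic_add_int) (simp add: closed_C1_curve_def)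

section \<open>Descending and ascending assignments of a cut diagram\<close>

definition first_strand :: "(real \<Rightarrow> complex) \<Rightarrow> complex \<Rightarrow> real" where
  "first_strand \<gamma> p = Min (strands \<gamma> p)"

definition second_strand :: "(real \<Rightarrow> complex) \<Rightarrow> complex \<Rightarrow> real" where
  "second_strand \<gamma> p = Max (strands \<gamma> p)"

text \<open>
  The overstrand is the one met first (or last, for \<open>ascending\<close>) when the curve is traversed from
  just after the parameter \<open>u\<close>; with \<open>u = -1\<close> the traversal starts before the parameter \<open>0\<close>.
\<close>

definition descending :: "(real \<Rightarrow> complex) \<Rightarrow> real \<Rightarrow> complex \<Rightarrow> real" where
  "descending \<gamma> u = (\<lambda>p\<in>crossings \<gamma>.
     if first_strand \<gamma> p \<le> u \<and> u < second_strand \<gamma> p then second_strand \<gamma> p else first_strand \<gamma> p)"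

definition ascending :: "(real \<Rightarrow> complex) \<Rightarrow> real \<Rightarrow> complex \<Rightarrow> real" where
  "ascending \<gamma> u = (\<lambda>p\<in>crossings \<gamma>.
     if first_strand \<gamma> p \<le> u \<and> u < second_strand \<gamma> p then first_strand \<gamma> p else second_strand \<gamma> p)"

context
  fixes \<gamma> :: "real \<Rightarrow> complex"
  assumes diagram: "free_knot_diagram \<gamma>"
begin

lemma crossing_strands:
  assumes "p \<in> crossings \<gamma>"
  shows "strands \<gamma> p = {first_strand \<gamma> p, second_strand \<gamma> p}"
    and "0 \<le> first_strand \<gamma> p" "first_strand \<gamma> p < second_strand \<gamma> p" "second_strand \<gamma> p < 1"
    and "\<gamma> (first_strand \<gamma> p) = p"
proof -
  have "card (strands \<gamma> p) = 2" using diagram assms by (simp add: free_knot_diagram_def)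
  then obtain s t where "strands \<gamma> p = {s, t}" "s \<noteq> t" by (meson card_2_iff)
  then obtain s t where st: "strands \<gamma> p = {s, t}" "s < t"
    by (metis insert_commute linorder_neqE)
  then have *: "first_strand \<gamma> p = s" "second_strand \<gamma> p = t"
    by (auto simp: first_strand_def second_strand_def)
  show "strands \<gamma> p = {first_strand \<gamma> p, second_strand \<gamma> p}"
    and "first_strand \<gamma> p < second_strand \<gamma> p" using st * by auto
  have "s \<in> strands \<gamma> p" "t \<in> strands \<gamma> p" using st by auto
  then show "0 \<le> first_strand \<gamma> p" "second_strand \<gamma> p < 1" "\<gamma> (first_strand \<gamma> p) = p"
    unfolding * by (auto simp: strands_def)
qed

text \<open>Finitely many strands leave a gap right after \<open>u\<close>, and the arc from
  \<open>a\<close> to \<open>b\<close> is placed inside it. Strands up to \<open>u\<close>, shifted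
  by one period, and strands after \<open>u\<close> then all lie between \<open>b\<close> and
  \<open>a + 1\<close>.\<close>

lemma crossing_free_arc:
  assumes u: "u = - 1 \<or> 0 \<le> u \<and> u < 1"
  obtains a b where "a < b" "b < a + 1" "b < 1"
    "\<And>p t. p \<in> crossings \<gamma> \<Longrightarrow> t \<in> strands \<gamma> p \<Longrightarrow> t \<le> u \<Longrightarrow> t < a"
    "\<And>p t. p \<in> crossings \<gamma> \<Longrightarrow> t \<in> strands \<gamma> p \<Longrightarrow> u < t \<Longrightarrow> b < t \<and> t < a + 1"
proof -
  define P where "P = (\<Union>p\<in>crossings \<gamma>. strands \<gamma> p)"
  have fin: "finite P"
    using diagram unfolding P_def
    by (intro finite_UN_I) (auto simp: free_knot_diagram_def intro: card_ge_0_finite)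
  have P: "0 \<le> t" "t < 1" if "t \<in> P" for t
    using that by (auto simp: P_def strands_def)
  have inP: "t \<in> P" if "p \<in> crossings \<gamma>" "t \<in> strands \<gamma> p" for p t
    using that by (auto simp: P_def)
  show ?thesis
  proof (cases "u = - 1")
    case True
    \<comment> \<open>The last crossing parameter, or 0 if there is none. The arc is chosen inside
      the gap between \<open>v - 1\<close> and 0, before the base point.\<close>
    define v where "v = Max (insert 0 P)"
    have v: "t \<le> v" if "t \<in> P" for t using that fin by (simp add: v_def)
    have "0 \<le> v" using fin by (simp add: v_def)
    moreover have "v < 1" unfolding v_def using fin P by (subst Max_less_iff) auto
    ultimately show ?thesis
    proof (intro that[of "(v - 1) / 2" "(v - 1) / 4"] conjI)
      fix p t assume t: "p \<in> crossings \<gamma>" "t \<in> strands \<gamma> p"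
      show "t < (v - 1) / 2" if "t \<le> u"
        using that P(1)[OF inP[OF t]] True by simp
      show "(v - 1) / 4 < t" "t < (v - 1) / 2 + 1"
        using P(1)[OF inP[OF t]] v[OF inP[OF t]] \<open>v < 1\<close> by (simp_all add: field_simps)
    qed (unfold diff_divide_distrib, linarith+)
  next
    case False
    \<comment> \<open>The next crossing parameter, or 1 if there is none. The arc is the middle
      third of the gap from \<open>u\<close> to \<open>v\<close>.\<close>
    define v where "v = Min (insert 1 {t \<in> P. u < t})"
    have v: "v \<le> t" if "t \<in> P" "u < t" for t using that fin by (simp add: v_def)
    have "v \<le> 1" using fin by (simp add: v_def)
    moreover have "u < v" unfolding v_def using fin u False by (subst Min_gr_iff) auto
    ultimately show ?thesis
    proof (intro that[of "u + (v - u) / 3" "u + 2 * (v - u) / 3"] conjI)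
      fix p t assume t: "p \<in> crossings \<gamma>" "t \<in> strands \<gamma> p"
      show "t < u + (v - u) / 3" if "t \<le> u"
        using that \<open>u < v\<close> by (simp add: field_simps)
      show "u + 2 * (v - u) / 3 < t" "t < u + (v - u) / 3 + 1" if "u < t"
        using v[OF inP[OF t] that] P(2)[OF inP[OF t]] u False \<open>u < v\<close> by (simp_all add: field_simps)
    qed (use u False in \<open>auto simp: field_simps\<close>)
  qed
qed

text \<open>A coincidence would make \<open>\<gamma> s\<close> a crossing, because \<open>s\<close>
  and \<open>t\<close> are less than a period apart and so differ modulo 1. Its strand
  \<open>frac s\<close> would then have to avoid the arc.\<close>

lemma crossing_free_arc_avoids_complement:
  assumes ab: "a < b" "b < a + 1" "b < 1"
    and free: "\<And>p t. p \<in> crossings \<gamma> \<Longrightarrow> t \<in> strands \<gamma> p \<Longrightarrow> t < a \<or> b < t \<and> t < a + 1"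
    and s: "a < s" "s < b" and t: "b < t" "t < a + 1"
  shows "\<gamma> s \<noteq> \<gamma> t"
proof
  assume eq: "\<gamma> s = \<gamma> t"
  have \<gamma>: "closed_C1_curve \<gamma>" using diagram by (simp add: free_knot_diagram_def immersed_circle_def)
  have frac: "frac r \<in> strands \<gamma> (\<gamma> r)" for r
    using closed_C1_curve_add_int[OF \<gamma>, of "frac r" "\<lfloor>r\<rfloor>"]
    by (simp add: strands_def frac_lt_1) (simp add: frac_def)
  have "frac s \<noteq> frac t"
  proof
    assume "frac s = frac t"
    then have "t - s = of_int (\<lfloor>t\<rfloor> - \<lfloor>s\<rfloor>)" by (simp add: frac_def)
    moreover have "0 < t - s" "t - s < 1" using s t by auto
    ultimately show False by (metis int_one_le_iff_zero_less not_le of_int_0_less_iff of_int_1_le_iff)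
  qed
  then have "\<gamma> s \<in> crossings \<gamma>"
    unfolding crossings_def using frac[of s] frac[of t] eq by auto
  from free[OF this frac] have "frac s < a \<or> b < frac s \<and> frac s < a + 1" .
  \<comment> \<open>Since \<open>s < 1\<close>, the fractional part is \<open>s\<close> itself,
    which lies on the arc, or at least \<open>s + 1\<close>, which exceeds \<open>a + 1\<close>.
    Both contradict \<open>free\<close>.\<close>
  moreover have "\<lfloor>s\<rfloor> \<le> 0" using s ab by linarith
  then have "\<lfloor>s\<rfloor> = 0 \<or> \<lfloor>s\<rfloor> \<le> - 1" by linarith
  then have "frac s = s \<or> frac s \<ge> s + 1"
    using of_int_le_iff[where ?'a = real, of "\<lfloor>s\<rfloor>" "- 1"] by (auto simp: frac_def)
  ultimately show False using s by linarith
qed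

text \<open>All crossings are met while the parameter runs from \<open>b\<close> to
  \<open>a + 1\<close>. A height monotone there orders the two strands of every crossing by time of
  passage, and the return takes place on the crossing-free arc.\<close>

lemma yields_unknot_descending_ascending:
  assumes u: "u = - 1 \<or> 0 \<le> u \<and> u < 1"
  shows "yields_unknot \<gamma> (descending \<gamma> u)" and "yields_unknot \<gamma> (ascending \<gamma> u)"
proof -
  obtain a b where ab: "a < b" "b < a + 1" "b < 1"
    and le: "\<And>p t. p \<in> crossings \<gamma> \<Longrightarrow> t \<in> strands \<gamma> p \<Longrightarrow> t \<le> u \<Longrightarrow> t < a"
    and gt: "\<And>p t. p \<in> crossings \<gamma> \<Longrightarrow> t \<in> strands \<gamma> p \<Longrightarrow> u < t \<Longrightarrow> b < t \<and> t < a + 1"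
    using crossing_free_arc[OF u] by metis
  have imm: "immersed_circle \<gamma>" and \<gamma>: "closed_C1_curve \<gamma>"
    using diagram by (simp_all add: free_knot_diagram_def immersed_circle_def)
  have disj: "\<gamma> s \<noteq> \<gamma> t" if "a < s" "s < b" "b < t" "t < a + 1" for s t
    by (rule crossing_free_arc_avoids_complement[OF ab _ that]) (use le gt in force)
  \<comment> \<open>Strands up to \<open>u\<close> are met only after the base point has been passed
    again, hence the extra period.\<close>
  define lift where "lift = (\<lambda>t. if t \<le> u then t + 1 else t)"
  have lift: "b < lift t" "lift t < a + 1" if "p \<in> crossings \<gamma>" "t \<in> strands \<gamma> p" for p t
    using le[OF that] gt[OF that] that ab by (auto simp: lift_def strands_def)
  have h_lift: "h (lift t) = h t" if "closed_C1_curve h" for h :: "real \<Rightarrow> real" and t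
    using that by (simp add: lift_def closed_C1_curve_def)
  have order: "lift (descending \<gamma> u p) < lift (ascending \<gamma> u p)"
      "strands \<gamma> p = {descending \<gamma> u p, ascending \<gamma> u p}" if "p \<in> crossings \<gamma>" for p
    using crossing_strands[OF that] that by (auto simp: descending_def ascending_def lift_def)
  have bounds: "b \<le> lift (descending \<gamma> u p)" "lift (ascending \<gamma> u p) \<le> a + 1"
    if "p \<in> crossings \<gamma>" for p
    using lift[OF that, of "descending \<gamma> u p"] lift[OF that, of "ascending \<gamma> u p"] order(2)[OF that]
    by auto

  \<comment> \<open>Maximum at \<open>b\<close>, minimum at \<open>a + 1\<close>: the height climbs
    back on the crossing-free arc shifted by one period.\<close>
  obtain h where h: "closed_C1_curve h" "unknot (range (\<lambda>t. (\<gamma> t, h t)))"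
    and dec: "\<And>s t. b \<le> s \<Longrightarrow> s < t \<Longrightarrow> t \<le> a + 1 \<Longrightarrow> h t < h s"
  proof (rule unknot_height_exists[OF imm])
    show "\<gamma> s \<noteq> \<gamma> t" if "b < s" "s < a + 1" "a + 1 < t" "t < b + 1" for s t
      using disj[of "t - 1" s] closed_C1_curve_add_int[OF \<gamma>, of "t - 1" 1] that by auto
  qed (use ab in auto)
  have "h (ascending \<gamma> u p) < h (descending \<gamma> u p)" if "p \<in> crossings \<gamma>" for p
    using dec[OF bounds(1)[OF that] order(1)[OF that] bounds(2)[OF that]] by (simp add: h_lift[OF h(1)])
  then have "\<forall>p\<in>crossings \<gamma>. \<forall>s\<in>strands \<gamma> p. s \<noteq> descending \<gamma> u p \<longrightarrow> h s < h (descending \<gamma> u p)"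
    using order(2) by simp
  with h(1) have "is_diagram_of \<gamma> (descending \<gamma> u) (range (\<lambda>t. (\<gamma> t, h t)))"
    unfolding is_diagram_of_def by (intro exI[of _ h]) simp
  then show "yields_unknot \<gamma> (descending \<gamma> u)" using h(2) by (auto simp: yields_unknot_def)

  \<comment> \<open>Maximum at \<open>a\<close> and minimum at \<open>b\<close>, so the height
    increases from \<open>b\<close> to \<open>a + 1\<close>.\<close>
  obtain h where h: "closed_C1_curve h" "unknot (range (\<lambda>t. (\<gamma> t, h t)))"
    and inc: "\<And>s t. b \<le> s \<Longrightarrow> s < t \<Longrightarrow> t \<le> a + 1 \<Longrightarrow> h s < h t"
    by (rule unknot_height_exists[OF imm ab(1,2) disj]) (assumption | rule that)+
  have "h (descending \<gamma> u p) < h (ascending \<gamma> u p)" if "p \<in> crossings \<gamma>" for p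
    using inc[OF bounds(1)[OF that] order(1)[OF that] bounds(2)[OF that]] by (simp add: h_lift[OF h(1)])
  then have "\<forall>p\<in>crossings \<gamma>. \<forall>s\<in>strands \<gamma> p. s \<noteq> ascending \<gamma> u p \<longrightarrow> h s < h (ascending \<gamma> u p)"
    using order(2) by simp
  with h(1) have "is_diagram_of \<gamma> (ascending \<gamma> u) (range (\<lambda>t. (\<gamma> t, h t)))"
    unfolding is_diagram_of_def by (intro exI[of _ h]) simp
  then show "yields_unknot \<gamma> (ascending \<gamma> u)" using h(2) by (auto simp: yields_unknot_def)
qed

section \<open>Counting the assignments\<close>

lemma finite_assignments: "finite (assignments \<gamma>)"
  using diagram unfolding assignments_def free_knot_diagram_def
  by (intro finite_PiE) (auto intro: card_ge_0_finite)

lemma descending_ascending_assignments: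
  "descending \<gamma> u \<in> assignments \<gamma>" "ascending \<gamma> u \<in> assignments \<gamma>"
  using crossing_strands(1) by (auto simp: assignments_def descending_def ascending_def)

lemma card_unknot_assignments: "2 * card (crossings \<gamma>) \<le> card {a \<in> assignments \<gamma>. yields_unknot \<gamma> a}"
proof (cases "crossings \<gamma> = {}")
  case False
  let ?C = "crossings \<gamma>" and ?s = "first_strand \<gamma>" and ?t = "second_strand \<gamma>"
  have fin: "finite ?C" using diagram by (simp add: free_knot_diagram_def)
  have inj: "inj_on ?s ?C" by (rule inj_on_inverseI[where g = \<gamma>]) (rule crossing_strands(5))
  have "Max (?s ` ?C) \<in> ?s ` ?C" using fin False by simp
  then obtain m where m: "m \<in> ?C" "Max (?s ` ?C) = ?s m" by auto
  have s_le: "?s p \<le> ?s m" if "p \<in> ?C" for p using that fin m(2) by (metis Max_ge finite_imageI imageI)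
  \<comment> \<open>The value \<open>- 1\<close> is the cut at the base point. It makes up for the
    omitted crossing \<open>m\<close>, so there are exactly as many cuts as crossings.\<close>
  define U where "U = insert (- 1) (?s ` (?C - {m}))"
  have U: "u = - 1 \<or> 0 \<le> u \<and> u < 1" if "u \<in> U" for u
  proof (cases "u = - 1")
    case False
    with that obtain p where "p \<in> ?C" "u = ?s p" by (auto simp: U_def)
    then show ?thesis using crossing_strands(2-4)[of p] by simp
  qed simp
  have "- 1 \<notin> ?s ` (?C - {m})" using crossing_strands(2) by force
  then have "card U = Suc (card (?C - {m}))"
    using fin inj by (simp add: U_def card_image inj_on_diff)
  then have card_U: "card U = card ?C" using card.remove[OF fin m(1)] by simp
  have U_m: "u < ?s m" if "u \<in> U" for u
  proof (cases "u = - 1")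
    case True
    then show ?thesis using crossing_strands(2)[OF m(1)] by simp
  next
    case False
    with that obtain p where p: "p \<in> ?C" "p \<noteq> m" "u = ?s p" by (auto simp: U_def)
    then show ?thesis using s_le[of p] inj_onD[OF inj _ p(1) m(1)] by fastforce
  qed
  \<comment> \<open>The later cut \<open>v\<close> is the first passage of some crossing
    \<open>q\<close>: cutting at \<open>v\<close> swaps the strands of \<open>q\<close>, cutting at
    the earlier \<open>u\<close> does not.\<close>
  have differ: "\<exists>q\<in>?C. descending \<gamma> u q \<noteq> descending \<gamma> v q \<and> ascending \<gamma> u q \<noteq> ascending \<gamma> v q"
    if uv: "u \<in> U" "v \<in> U" "u < v" for u v
  proof -
    have "v \<noteq> - 1" using uv U by force
    then obtain q where q: "q \<in> ?C" "v = ?s q" using uv by (auto simp: U_def)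
    show ?thesis
      using q uv(3) crossing_strands(3)[OF q(1)]
      by (intro bexI[of _ q]) (auto simp: descending_def ascending_def)
  qed
  have inj_U: "inj_on (descending \<gamma>) U" "inj_on (ascending \<gamma>) U"
    by (rule linorder_inj_onI'; use differ in fastforce)+
  \<comment> \<open>Every cut precedes the first passage through \<open>m\<close>, so no cut swaps
    the strands there.\<close>
  have "descending \<gamma> u \<noteq> ascending \<gamma> v" if "u \<in> U" "v \<in> U" for u v
  proof -
    have "descending \<gamma> u m = ?s m" "ascending \<gamma> v m = ?t m"
      using m(1) U_m[OF that(1)] U_m[OF that(2)] by (auto simp: descending_def ascending_def)
    then show ?thesis using crossing_strands(3)[OF m(1)] by auto
  qed
  then have "descending \<gamma> ` U \<inter> ascending \<gamma> ` U = {}" by auto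
  moreover have "finite U" using fin by (simp add: U_def)
  ultimately have "card (descending \<gamma> ` U \<union> ascending \<gamma> ` U) = 2 * card ?C"
    using inj_U card_U by (simp add: card_Un_disjoint card_image)
  moreover have "descending \<gamma> ` U \<union> ascending \<gamma> ` U \<subseteq> {a \<in> assignments \<gamma>. yields_unknot \<gamma> a}"
    using U yields_unknot_descending_ascending descending_ascending_assignments by blast
  moreover have "finite {a \<in> assignments \<gamma>. yields_unknot \<gamma> a}" using finite_assignments by simp
  ultimately show ?thesis by (metis card_mono)
qed simp

section \<open>From counting to probability\<close>

text \<open>Independent uniform choices give the uniform distribution on the product set. The
  default \<open>undefined\<close> makes that product agree with the extensional functions in
  \<open>assignments\<close>.\<close>

lemma random_assignment_uniform: "random_assignment \<gamma> = pmf_of_set (assignments \<gamma>)"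
proof -
  have "PiE_dflt (crossings \<gamma>) undefined (strands \<gamma>) = assignments \<gamma>"
    by (auto simp: PiE_dflt_def assignments_def PiE_def extensional_def)
  then show ?thesis
    unfolding random_assignment_def using diagram crossing_strands(1)
    by (subst Pi_pmf_of_set) (auto simp: free_knot_diagram_def)
qed

lemma prob_unknot_assignment:
  "measure_pmf.prob (random_assignment \<gamma>) {a. yields_unknot \<gamma> a}
     = card {a \<in> assignments \<gamma>. yields_unknot \<gamma> a} / 2 ^ card (crossings \<gamma>)"
proof -
  have "assignments \<gamma> \<noteq> {}" using card_assignments[OF diagram] by force
  then show ?thesis
    using finite_assignments card_assignments[OF diagram]
    by (simp add: random_assignment_uniform measure_pmf_of_set Collect_conj_eq)
qed

end

theorem theorem1p1:
  fixes \<gamma> :: "real \<Rightarrow> complex" and n :: nat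
  assumes "free_knot_diagram \<gamma>"
    and "card (crossings \<gamma>) = n"
  shows "measure_pmf.prob (random_assignment \<gamma>) {a. yields_unknot \<gamma> a} \<ge> real (2 * n) / 2 ^ n
       \<and> card {a \<in> assignments \<gamma>. yields_unknot \<gamma> a} \<ge> 2 * n"
proof
  show card: "card {a \<in> assignments \<gamma>. yields_unknot \<gamma> a} \<ge> 2 * n"
    using card_unknot_assignments[OF assms(1)] assms(2) by simp
  show "measure_pmf.prob (random_assignment \<gamma>) {a. yields_unknot \<gamma> a} \<ge> real (2 * n) / 2 ^ n"
    unfolding prob_unknot_assignment[OF assms(1)] assms(2)
    using card by (intro divide_right_mono) (simp_all only: of_nat_le_iff, simp)
qed

end
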